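(* Let $\mu,\nu>0$ with $\mu+\nu=1$, let $N\ge 1$ be an integer, and let $(E_N(t))_{t\ge 0}$ be the Ehrenfest process with $N$ particles and parameters $\nu,\mu$. For every $\beta\in\mathbb{R}$, the process $$\left(M_N^\beta(t)\right)_{t\ge 0}=\left(\left(1-\beta\mu e^{t}\right)^{E_N(t)}\left(1+\beta\nu e^{t}\right)^{N-E_N(t)}\right)_{t\ge 0}$$ is a martingale (with respect to the natural filtration of $(E_N(t))$).
   Context: The Ehrenfest process $(E_N(t))_{t\ge0}$ with $N$ particles and parameters $\nu,\mu>0$ is the continuous-time (right-continuous) birth and death Markov process on $\{0,1,\ldots,N\}$ with transition rates $q(x,x+1)=\nu(N-x)$ and $q(x,x-1)=\mu x$ for $0\le x\le N$. Equivalently, $E_N(t)=Y_1(t)+\cdots+Y_N(t)$, where $(Y_i(t))$, $1\le i\le N$, are independent Markov jump processes on $\{0,1\}$ jumping from $0$ to $1$ at rate $\nu$ and from $1$ to $0$ at rate $\mu$. The time scale is normalized so that $\mu+\nu=1$. Convention: $0^0=1$. *)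

theory Defs
  imports "HOL-Probability.Probability"
begin

text \<open>
  Processes are indexed by \<^typ>\<open>real\<close>, but only the times \<open>t \<ge> 0\<close> are ever considered.
\<close>

definition natural_filtration :: "'a measure \<Rightarrow> (real \<Rightarrow> 'a \<Rightarrow> nat) \<Rightarrow> real \<Rightarrow> 'a measure" where
  "natural_filtration M X t =
     sigma (space M) {X s -` A \<inter> space M | s A. 0 \<le> s \<and> s \<le> t}"

definition martingale :: "'a measure \<Rightarrow> (real \<Rightarrow> 'a measure) \<Rightarrow> (real \<Rightarrow> 'a \<Rightarrow> real) \<Rightarrow> bool" where
  "martingale M F Z \<longleftrightarrow>
     (\<forall>t\<ge>0. subalgebra M (F t)) \<and>
     (\<forall>s\<ge>0. \<forall>t\<ge>s. sets (F s) \<subseteq> sets (F t)) \<and>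
     (\<forall>t\<ge>0. Z t \<in> borel_measurable (F t)) \<and>
     (\<forall>t\<ge>0. integrable M (Z t)) \<and>
     (\<forall>s\<ge>0. \<forall>t\<ge>s. AE \<omega> in M. real_cond_exp M (F s) (Z t) \<omega> = Z s \<omega>)"

definition transition_semigroup :: "nat set \<Rightarrow> (real \<Rightarrow> nat \<Rightarrow> nat \<Rightarrow> real) \<Rightarrow> bool" where
  "transition_semigroup S p \<longleftrightarrow>
     (\<forall>t\<ge>0. \<forall>x\<in>S. \<forall>y\<in>S. 0 \<le> p t x y) \<and>
     (\<forall>t\<ge>0. \<forall>x\<in>S. (\<Sum>y\<in>S. p t x y) = 1) \<and>
     (\<forall>x\<in>S. \<forall>y\<in>S. p 0 x y = (if x = y then 1 else 0)) \<and>
     (\<forall>s\<ge>0. \<forall>t\<ge>0. \<forall>x\<in>S. \<forall>y\<in>S. p (s + t) x y = (\<Sum>z\<in>S. p s x z * p t z y))"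

text \<open>
  The rates are the right derivatives at time 0 of the off-diagonal transition probabilities.
  On a finite state space the rows of \<open>p t\<close> sum to 1, so this also forces the
  diagonal derivative at 0 to be minus the total jump rate, and \<open>p t\<close> to tend to the
  identity as \<open>t\<close> decreases to 0.
\<close>

definition has_transition_rates ::
    "nat set \<Rightarrow> (real \<Rightarrow> nat \<Rightarrow> nat \<Rightarrow> real) \<Rightarrow> (nat \<Rightarrow> nat \<Rightarrow> real) \<Rightarrow> bool" where
  "has_transition_rates S p q \<longleftrightarrow>
     (\<forall>x\<in>S. \<forall>y\<in>S. x \<noteq> y \<longrightarrow> ((\<lambda>h. p h x y / h) \<longlongrightarrow> q x y) (at_right 0))"

text \<open>
  A time-homogeneous Markov process with right-continuous paths on a finite state space
  (with the discrete topology) and arbitrary initial law; the Markov property is with respect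
  to the natural filtration.
\<close>

definition markov_process_with_rates ::
    "'a measure \<Rightarrow> nat set \<Rightarrow> (nat \<Rightarrow> nat \<Rightarrow> real) \<Rightarrow> (real \<Rightarrow> 'a \<Rightarrow> nat) \<Rightarrow> bool" where
  "markov_process_with_rates M S q X \<longleftrightarrow>
     prob_space M \<and> finite S \<and>
     (\<forall>t\<ge>0. X t \<in> measurable M (count_space S)) \<and>
     (\<forall>\<omega>\<in>space M. \<forall>t\<ge>0. continuous (at_right t) (\<lambda>s. X s \<omega>)) \<and>
     (\<exists>p. transition_semigroup S p \<and> has_transition_rates S p q \<and>
        (\<forall>s\<ge>0. \<forall>t\<ge>0. \<forall>y\<in>S. AE \<omega> in M.
           real_cond_exp M (natural_filtration M X s)
             (\<lambda>\<omega>'. indicator {y} (X (s + t) \<omega>')) \<omega> = p t (X s \<omega>) y))"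

definition ehrenfest_rate :: "nat \<Rightarrow> real \<Rightarrow> real \<Rightarrow> nat \<Rightarrow> nat \<Rightarrow> real" where
  "ehrenfest_rate N \<nu> \<mu> x y =
     (if y = x + 1 then \<nu> * (real N - real x)
      else if x = y + 1 then \<mu> * real x
      else 0)"

definition ehrenfest_process ::
    "'a measure \<Rightarrow> nat \<Rightarrow> real \<Rightarrow> real \<Rightarrow> (real \<Rightarrow> 'a \<Rightarrow> nat) \<Rightarrow> bool" where
  "ehrenfest_process M N \<nu> \<mu> E \<longleftrightarrow>
     markov_process_with_rates M {0..N} (ehrenfest_rate N \<nu> \<mu>) E"

end

(* On a finite state space the transition semigroup satisfies Kolmogorov's forward equation, so
   if d/dt g(t, x) = - (Q g(t, .))(x) for the generator Q, then the mean of g(s + t, .) under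
   p t x has derivative 0 in t and equals g(s, x); the Markov property turns this into the
   martingale property of g(t, X t). For the Ehrenfest rates,
   g(t, x) = (1 - beta mu e^t)^x (1 + beta nu e^t)^(N - x) solves this equation. *)

theory Submission
  imports Defs
begin

section \<open>The natural filtration\<close>

lemma sets_natural_filtration_subset:
  fixes X :: "real \<Rightarrow> 'a \<Rightarrow> nat"
  assumes "\<And>t. t \<ge> 0 \<Longrightarrow> X t \<in> measurable M (count_space S)"
  shows "{X s -` A \<inter> space M | s A. 0 \<le> s \<and> s \<le> t} \<subseteq> sets M"
proof clarify
  fix s A assume s: "0 \<le> s" "s \<le> t"
  \<comment> \<open>The filtration is generated by preimages of arbitrary \<open>A\<close>, but
    measurability is known only for subsets of \<open>S\<close>; as \<open>X s\<close> takes values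
    in \<open>S\<close>, cutting \<open>A\<close> down to \<open>A \<inter> S\<close> leaves the
    preimage unchanged.\<close>
  have "X s -` A \<inter> space M = X s -` (A \<inter> S) \<inter> space M"
    using measurable_space[OF assms[OF s(1)]] by auto
  also have "\<dots> \<in> sets M"
    by (rule measurable_sets[OF assms[OF s(1)]]) simp
  finally show "X s -` A \<inter> space M \<in> sets M" .
qed

lemma subalgebra_natural_filtration:
  assumes "\<And>t. t \<ge> 0 \<Longrightarrow> X t \<in> measurable M (count_space S)"
  shows "subalgebra M (natural_filtration M X t)"
proof -
  let ?G = "{X s -` A \<inter> space M | s A. 0 \<le> s \<and> s \<le> t}"
  have "sigma_sets (space M) ?G \<subseteq> sets M"
    by (rule sets.sigma_sets_subset[OF sets_natural_filtration_subset[OF assms]])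
  moreover have "?G \<subseteq> Pow (space M)" by auto
  ultimately show ?thesis
    unfolding subalgebra_def natural_filtration_def by simp
qed

lemma sets_natural_filtration_mono:
  assumes "s \<le> t"
  shows "sets (natural_filtration M X s) \<subseteq> sets (natural_filtration M X t)"
proof -
  have "{X r -` A \<inter> space M | r A. 0 \<le> r \<and> r \<le> s}
      \<subseteq> {X r -` A \<inter> space M | r A. 0 \<le> r \<and> r \<le> t}"
    using assms by force
  then have "sigma_sets (space M) {X r -` A \<inter> space M | r A. 0 \<le> r \<and> r \<le> s}
      \<subseteq> sigma_sets (space M) {X r -` A \<inter> space M | r A. 0 \<le> r \<and> r \<le> t}"
    by (rule sigma_sets_subseteq)
  moreover have "{X r -` A \<inter> space M | r A. 0 \<le> r \<and> r \<le> u} \<subseteq> Pow (space M)" for u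
    by auto
  ultimately show ?thesis
    unfolding natural_filtration_def by simp
qed

lemma measurable_natural_filtration:
  assumes "t \<ge> 0"
  shows "X t \<in> measurable (natural_filtration M X t) (count_space UNIV)"
proof (rule measurableI)
  fix A
  show "X t -` A \<inter> space (natural_filtration M X t) \<in> sets (natural_filtration M X t)"
    unfolding natural_filtration_def
    using assms by (auto intro!: sigma_sets.Basic simp: sets_measure_of_conv space_measure_of_conv)
qed simp

section \<open>Kolmogorov's forward equation on a finite state space\<close>

lemma filterlim_dist_at_right_0:
  "filterlim (\<lambda>v. \<bar>v - u\<bar>) (at_right 0) (at u within A)" for u :: real
proof -
  \<comment> \<open>Whichever side \<open>v\<close> comes from, the gap
    \<open>\<bar>v - u\<bar>\<close> tends to 0 through positive values, so right limits at time 0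
    can be composed with it.\<close>
  have "((\<lambda>v. \<bar>v - u\<bar>) \<longlongrightarrow> \<bar>u - u\<bar>) (at u within A)"
    by (intro tendsto_intros)
  moreover have "\<forall>\<^sub>F v in at u within A. 0 < \<bar>v - u\<bar>"
    by (simp add: eventually_at_filter)
  ultimately show ?thesis
    by (simp add: filterlim_at_right_to_0 filterlim_at eventually_mono)
qed

text \<open>Written with differences, so that the summand \<open>y = x\<close> vanishes whatever
  \<open>q x x\<close> is: \<open>has_transition_rates\<close> fixes only the off-diagonal
  rates.\<close>

definition generator_on :: "nat set \<Rightarrow> (nat \<Rightarrow> nat \<Rightarrow> real) \<Rightarrow> (nat \<Rightarrow> real) \<Rightarrow> nat \<Rightarrow> real" where
  "generator_on S q \<phi> x = (\<Sum>y\<in>S. q x y * (\<phi> y - \<phi> x))"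

context
  fixes S :: "nat set" and p :: "real \<Rightarrow> nat \<Rightarrow> nat \<Rightarrow> real" and q :: "nat \<Rightarrow> nat \<Rightarrow> real"
  assumes fin: "finite S" and semigroup: "transition_semigroup S p"
    and rates: "has_transition_rates S p q"
begin

abbreviation "generator \<equiv> generator_on S q"

lemma transition_nonneg: "t \<ge> 0 \<Longrightarrow> x \<in> S \<Longrightarrow> y \<in> S \<Longrightarrow> 0 \<le> p t x y"
  and transition_sum: "t \<ge> 0 \<Longrightarrow> x \<in> S \<Longrightarrow> (\<Sum>y\<in>S. p t x y) = 1"
  and transition_zero: "x \<in> S \<Longrightarrow> y \<in> S \<Longrightarrow> p 0 x y = of_bool (x = y)"
  and transition_add: "s \<ge> 0 \<Longrightarrow> t \<ge> 0 \<Longrightarrow> x \<in> S \<Longrightarrow> y \<in> S \<Longrightarrow>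
    p (s + t) x y = (\<Sum>z\<in>S. p s x z * p t z y)"
  using semigroup unfolding transition_semigroup_def by auto

lemma transition_le_1:
  assumes "t \<ge> 0" "x \<in> S" "y \<in> S"
  shows "p t x y \<le> 1"
  using member_le_sum[of y S "p t x"] transition_nonneg transition_sum assms fin by simp

text \<open>Expand \<open>\<phi>\<close> in indicators of states. The generator of the indicator of
  \<open>y\<close>, evaluated at \<open>x\<close>, is the entry (x, y) of the Q-matrix, whose
  diagonal is minus the total jump rate.\<close>

lemma generator_eq_sum_of_bool:
  "generator \<phi> x = (\<Sum>y\<in>S. generator (\<lambda>w. of_bool (w = y)) x * \<phi> y)" if "x \<in> S"
proof -
  have "(\<Sum>y\<in>S. generator (\<lambda>w. of_bool (w = y)) x * \<phi> y) =
      (\<Sum>y\<in>S. \<Sum>w\<in>S. q x w * (of_bool (w = y) * \<phi> y - of_bool (x = y) * \<phi> y))"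
    unfolding generator_on_def
    by (simp add: sum_distrib_right left_diff_distrib right_diff_distrib mult.assoc)
  also have "\<dots> = (\<Sum>w\<in>S. \<Sum>y\<in>S. q x w * (of_bool (w = y) * \<phi> y - of_bool (x = y) * \<phi> y))"
    by (rule sum.swap)
  also have "\<dots> = (\<Sum>w\<in>S. q x w * ((\<Sum>y\<in>S. of_bool (w = y) * \<phi> y) - (\<Sum>y\<in>S. of_bool (x = y) * \<phi> y)))"
    by (simp only: sum_distrib_left[symmetric] sum_subtractf)
  also have "\<dots> = generator \<phi> x"
    unfolding generator_on_def using fin that by (intro sum.cong) (auto simp: of_bool_def if_distrib[of "\<lambda>a. a * _"] cong: if_cong)
  finally show ?thesis by simp
qed

text \<open>Since the row of \<open>p h\<close> sums to 1, \<open>\<phi> x\<close> can be moved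
  inside the sum. The diagonal term then vanishes and every other term converges by the definition
  of the rates.\<close>

lemma transition_right_derivative:
  assumes "x \<in> S"
  shows "((\<lambda>h. ((\<Sum>y\<in>S. p h x y * \<phi> y) - \<phi> x) / h) \<longlongrightarrow> generator \<phi> x) (at_right 0)"
proof -
  have "((\<lambda>h. \<Sum>y\<in>S. p h x y / h * (\<phi> y - \<phi> x)) \<longlongrightarrow> generator \<phi> x) (at_right 0)"
    unfolding generator_on_def
  proof (rule tendsto_sum)
    fix y assume "y \<in> S"
    then show "((\<lambda>h. p h x y / h * (\<phi> y - \<phi> x)) \<longlongrightarrow> q x y * (\<phi> y - \<phi> x)) (at_right 0)"
      using rates assms unfolding has_transition_rates_def
      by (cases "x = y") (simp, intro tendsto_mult tendsto_const, blast)
  qed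
  moreover have "\<forall>\<^sub>F h in at_right 0. (\<Sum>y\<in>S. p h x y / h * (\<phi> y - \<phi> x)) =
      ((\<Sum>y\<in>S. p h x y * \<phi> y) - \<phi> x) / h"
    using eventually_at_right_less
  proof eventually_elim
    case (elim h)
    have "(\<Sum>y\<in>S. p h x y / h * (\<phi> y - \<phi> x)) =
        ((\<Sum>y\<in>S. p h x y * \<phi> y) - (\<Sum>y\<in>S. p h x y) * \<phi> x) / h"
      by (simp add: sum_divide_distrib sum_distrib_right sum_subtractf right_diff_distrib diff_divide_distrib)
    then show ?case using transition_sum[of h x] elim assms by simp
  qed
  ultimately show ?thesis by (rule Lim_transform_eventually)
qed

lemma transition_right_derivative_of_bool:
  assumes "x \<in> S" "y \<in> S"
  shows "((\<lambda>h. (p h x y - of_bool (x = y)) / h) \<longlongrightarrow> generator (\<lambda>w. of_bool (w = y)) x) (at_right 0)"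
  using transition_right_derivative[OF assms(1), of "\<lambda>w. of_bool (w = y)"] assms fin
  by (simp add: of_bool_def if_distrib[of "\<lambda>a. _ * a"] cong: if_cong)

lemma transition_tendsto_of_bool:
  assumes "x \<in> S" "y \<in> S"
  shows "((\<lambda>h. p h x y - of_bool (x = y)) \<longlongrightarrow> 0) (at_right 0)"
proof -
  have "((\<lambda>h. h * ((p h x y - of_bool (x = y)) / h)) \<longlongrightarrow>
      0 * generator (\<lambda>w. of_bool (w = y)) x) (at_right 0)"
    by (intro tendsto_mult transition_right_derivative_of_bool assms tendsto_ident_at)
  moreover have "\<forall>\<^sub>F h in at_right 0. h * ((p h x y - of_bool (x = y)) / h) = p h x y - of_bool (x = y)"
    using eventually_at_right_less by eventually_elim simp
  ultimately show ?thesis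
    by (simp add: tendsto_cong)
qed

text \<open>In matrix form P(u+h) - P(u) = P(u)(P(h) - I), by Chapman-Kolmogorov. Keeping P(h) - I
  on the right is what leads to the forward equation.\<close>

lemma transition_diff:
  assumes "u \<ge> 0" "h \<ge> 0" "x \<in> S" "y \<in> S"
  shows "p (u + h) x y - p u x y = (\<Sum>z\<in>S. p u x z * (p h z y - of_bool (z = y)))"
proof -
  have "(\<Sum>z\<in>S. p u x z * of_bool (z = y)) = p u x y"
    using fin assms by (simp add: of_bool_def if_distrib[of "\<lambda>a. _ * a"] cong: if_cong)
  then show ?thesis
    using transition_add[OF assms] by (simp add: right_diff_distrib sum_subtractf)
qed

text \<open>Expanding from the earlier of the two times treats \<open>v > u\<close> and
  \<open>v < u\<close> alike: swapping the times flips the sign of the increment, which the absolute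
  value hides and the quotient cancels.\<close>

lemma transition_diff_min:
  assumes "u \<ge> 0" "v \<ge> 0" "x \<in> S" "y \<in> S"
  shows "\<bar>p v x y - p u x y\<bar> = \<bar>\<Sum>z\<in>S. p (min u v) x z * (p \<bar>v - u\<bar> z y - of_bool (z = y))\<bar>"
    and "(p v x y - p u x y) / (v - u) =
      (\<Sum>z\<in>S. p (min u v) x z * ((p \<bar>v - u\<bar> z y - of_bool (z = y)) / \<bar>v - u\<bar>))"
  using transition_diff[of u "v - u" x y] transition_diff[of v "u - v" x y] assms
    minus_divide_divide[of "p v x y - p u x y" "v - u"]
  by (cases "u \<le> v"; simp add: sum_divide_distrib[symmetric] min_def abs_minus_commute; fail)+

text \<open>The weights \<open>p (min u v) x z\<close> lie in [0, 1], so the increment is dominated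
  by the entries of P(h) - I with \<open>h = \<bar>v - u\<bar>\<close>, which tend to 0.\<close>

lemma transition_continuous:
  assumes "u \<ge> 0" "x \<in> S" "y \<in> S"
  shows "((\<lambda>v. p v x y) \<longlongrightarrow> p u x y) (at u within {0..})"
proof (subst LIM_zero_iff[symmetric], rule Lim_null_comparison)
  let ?d = "\<lambda>v z. p \<bar>v - u\<bar> z y - of_bool (z = y)"
  have "\<forall>\<^sub>F v in at u within {0..}. 0 \<le> v"
    by (simp add: eventually_at_filter)
  then show "\<forall>\<^sub>F v in at u within {0..}. norm (p v x y - p u x y) \<le> (\<Sum>z\<in>S. \<bar>?d v z\<bar>)"
  proof eventually_elim
    case (elim v)
    have "\<bar>p v x y - p u x y\<bar> \<le> (\<Sum>z\<in>S. \<bar>p (min u v) x z * ?d v z\<bar>)"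
      using transition_diff_min(1)[of u v x y] assms elim by (simp add: sum_abs)
    also have "\<dots> \<le> (\<Sum>z\<in>S. \<bar>?d v z\<bar>)"
      using transition_nonneg[of "min u v" x] transition_le_1[of "min u v" x] assms elim
      by (intro sum_mono) (simp add: abs_mult mult_left_le_one_le)
    finally show ?case by simp
  qed
  show "((\<lambda>v. \<Sum>z\<in>S. \<bar>?d v z\<bar>) \<longlongrightarrow> 0) (at u within {0..})"
    by (intro tendsto_null_sum tendsto_rabs_zero
        filterlim_compose[OF transition_tendsto_of_bool filterlim_dist_at_right_0] assms)
qed

text \<open>In the factored difference quotient one factor tends to P(u) by continuity and the other
  to the derivative of P at 0. The derivative is taken within \<open>{0..}\<close> because nothing
  is assumed about \<open>p\<close> at negative times.\<close>

lemma kolmogorov_forward: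
  assumes "u \<ge> 0" "x \<in> S" "y \<in> S"
  shows "((\<lambda>v. p v x y) has_real_derivative
    (\<Sum>z\<in>S. p u x z * generator (\<lambda>w. of_bool (w = y)) z)) (at u within {0..})"
  unfolding has_field_derivative_iff
proof (rule Lim_transform_eventually)
  show "((\<lambda>v. \<Sum>z\<in>S. p (min u v) x z * ((p \<bar>v - u\<bar> z y - of_bool (z = y)) / \<bar>v - u\<bar>)) \<longlongrightarrow>
      (\<Sum>z\<in>S. p u x z * generator (\<lambda>w. of_bool (w = y)) z)) (at u within {0..})"
  proof (intro tendsto_sum tendsto_mult)
    fix z assume z: "z \<in> S"
    show "((\<lambda>v. (p \<bar>v - u\<bar> z y - of_bool (z = y)) / \<bar>v - u\<bar>) \<longlongrightarrow>
        generator (\<lambda>w. of_bool (w = y)) z) (at u within {0..})"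
      by (rule filterlim_compose[OF transition_right_derivative_of_bool filterlim_dist_at_right_0])
         (use z assms in auto)
    \<comment> \<open>For \<open>v < u\<close> the base point \<open>min u v\<close> moves with
      \<open>v\<close>, so the first factor is not constant and continuity of \<open>p\<close> has
      to supply its limit.\<close>
    have "continuous_on {0..} (\<lambda>v. p v x z)"
      unfolding continuous_on_def using transition_continuous assms z by auto
    then have "continuous_on {0..} (\<lambda>v. p (min u v) x z)"
      by (rule continuous_on_compose2) (auto intro!: continuous_intros simp: assms)
    then have "continuous (at u within {0..}) (\<lambda>v. p (min u v) x z)"
      using assms(1) by (simp add: continuous_on_eq_continuous_within)
    then show "((\<lambda>v. p (min u v) x z) \<longlongrightarrow> p u x z) (at u within {0..})"
      by (simp add: continuous_within)
  qed
  have "\<forall>\<^sub>F v in at u within {0..}. 0 \<le> v"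
    by (simp add: eventually_at_filter)
  then show "\<forall>\<^sub>F v in at u within {0..}.
      (\<Sum>z\<in>S. p (min u v) x z * ((p \<bar>v - u\<bar> z y - of_bool (z = y)) / \<bar>v - u\<bar>)) =
      (p v x y - p u x y) / (v - u)"
    by eventually_elim (simp add: transition_diff_min(2) assms)
qed

text \<open>By the product rule, differentiating \<open>p\<close> by the forward equation gives the
  mean of the generator applied to \<open>g (s + u)\<close>, and differentiating \<open>g\<close>
  gives its negative. The mean is thus constant in \<open>u\<close>, and at \<open>u = 0\<close> the
  matrix P(0) = I yields \<open>g s x\<close>.\<close>

lemma transition_space_time_harmonic:
  assumes g: "\<And>t x. t \<ge> 0 \<Longrightarrow> x \<in> S \<Longrightarrow>
      ((\<lambda>t. g t x) has_real_derivative - generator (g t) x) (at t)"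
    and "s \<ge> 0" "t \<ge> 0" "x \<in> S"
  shows "(\<Sum>y\<in>S. p t x y * g (s + t) y) = g s x"
proof -
  define G where "G u = (\<Sum>y\<in>S. p u x y * g (s + u) y)" for u
  have "(G has_real_derivative 0) (at u within {0..})" if u: "u \<ge> 0" for u
  proof -
    have "((\<lambda>u. g (s + u) y) has_real_derivative - generator (g (s + u)) y) (at u within {0..})"
      if "y \<in> S" for y
    proof -
      have "((\<lambda>u. g (s + u) y) has_real_derivative - generator (g (s + u)) y * 1) (at u within {0..})"
        by (rule DERIV_chain2[where f = "\<lambda>t. g t y"])
           (use g that u assms in \<open>auto intro!: derivative_eq_intros\<close>)
      then show ?thesis by simp
    qed
    then have "(G has_real_derivative (\<Sum>y\<in>S. (\<Sum>z\<in>S. p u x z * generator (\<lambda>w. of_bool (w = y)) z) * g (s + u) y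
        + - generator (g (s + u)) y * p u x y)) (at u within {0..})"
      unfolding G_def using u assms
      by (intro DERIV_sum DERIV_mult kolmogorov_forward) auto
    also have "(\<Sum>y\<in>S. (\<Sum>z\<in>S. p u x z * generator (\<lambda>w. of_bool (w = y)) z) * g (s + u) y
        + - generator (g (s + u)) y * p u x y) =
      (\<Sum>y\<in>S. \<Sum>z\<in>S. p u x z * (generator (\<lambda>w. of_bool (w = y)) z * g (s + u) y))
        - (\<Sum>z\<in>S. p u x z * generator (g (s + u)) z)"
      by (simp add: sum_subtractf sum_distrib_right mult.assoc mult.commute[of "generator _ _" "p _ _ _"])
    \<comment> \<open>Summing over \<open>y\<close> first reassembles \<open>g (s + u)\<close> from
      its indicators, which moves the generator from the transition probabilities onto
      \<open>g\<close>.\<close>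
    also have "(\<Sum>y\<in>S. \<Sum>z\<in>S. p u x z * (generator (\<lambda>w. of_bool (w = y)) z * g (s + u) y)) =
        (\<Sum>z\<in>S. p u x z * generator (g (s + u)) z)"
      by (subst sum.swap)
         (simp add: sum_distrib_left[symmetric] generator_eq_sum_of_bool[symmetric])
    finally show ?thesis by simp
  qed
  then obtain c where "\<And>u. u \<in> {0..} \<Longrightarrow> G u = c"
    using has_field_derivative_zero_constant[of "{0::real..}" G] by auto
  then have "G t = G 0" using assms by simp
  also have "G 0 = g s x"
    unfolding G_def using fin assms by (simp add: transition_zero of_bool_def if_distrib[of "\<lambda>a. a * _"] cong: if_cong)
  finally show ?thesis unfolding G_def .
qed

end

section \<open>From space-time harmonic functions to martingales\<close>

lemma martingale_space_time_harmonic: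
  assumes X: "markov_process_with_rates M S q X"
    and g: "\<And>t x. t \<ge> 0 \<Longrightarrow> x \<in> S \<Longrightarrow>
      ((\<lambda>t. g t x) has_real_derivative - (\<Sum>y\<in>S. q x y * (g t y - g t x))) (at t)"
  shows "martingale M (natural_filtration M X) (\<lambda>t \<omega>. g t (X t \<omega>))"
proof -
  from X obtain p where prob: "prob_space M" and fin: "finite S"
    and meas: "\<And>t. t \<ge> 0 \<Longrightarrow> X t \<in> measurable M (count_space S)"
    and p: "transition_semigroup S p" "has_transition_rates S p q"
    and markov: "\<And>s t y. s \<ge> 0 \<Longrightarrow> t \<ge> 0 \<Longrightarrow> y \<in> S \<Longrightarrow> AE \<omega> in M.
        real_cond_exp M (natural_filtration M X s) (\<lambda>\<omega>'. indicator {y} (X (s + t) \<omega>')) \<omega>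
          = p t (X s \<omega>) y"
    unfolding markov_process_with_rates_def by auto
  interpret prob_space M by (rule prob)
  have sub: "subalgebra M (natural_filtration M X t)" for t
    by (rule subalgebra_natural_filtration[OF meas])
  have int: "integrable M (\<lambda>\<omega>. \<phi> (X t \<omega>))" if "t \<ge> 0" for t and \<phi> :: "nat \<Rightarrow> real"
  proof (rule integrable_const_bound)
    \<comment> \<open>Finiteness of \<open>S\<close> makes every function of the state bounded; the
      sum of all its absolute values is a convenient bound.\<close>
    show "AE \<omega> in M. norm (\<phi> (X t \<omega>)) \<le> (\<Sum>y\<in>S. norm (\<phi> y))"
      using measurable_space[OF meas[OF that]] fin
      by (intro AE_I2 member_le_sum) auto
    show "(\<lambda>\<omega>. \<phi> (X t \<omega>)) \<in> borel_measurable M"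
      by (rule measurable_compose[OF meas[OF that]]) simp
  qed
  have cond: "AE \<omega> in M. real_cond_exp M (natural_filtration M X s) (\<lambda>\<omega>. g t (X t \<omega>)) \<omega> = g s (X s \<omega>)"
    if s: "s \<ge> 0" "s \<le> t" for s t
  proof -
    let ?F = "natural_filtration M X s"
    interpret finite_measure_subalgebra M ?F
      by unfold_locales (rule sub)
    have t: "t \<ge> 0" using s by simp
    let ?I = "\<lambda>y \<omega>. indicator {y} (X t \<omega>) :: real"
    \<comment> \<open>The Markov property is available only for indicators of single states, so
      \<open>g t (X t \<omega>)\<close> is split into finitely many of them.\<close>
    have "AE \<omega> in M. real_cond_exp M ?F (\<lambda>\<omega>. g t (X t \<omega>)) \<omega> =
        real_cond_exp M ?F (\<lambda>\<omega>. \<Sum>y\<in>S. g t y * ?I y \<omega>) \<omega>"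
    proof (rule real_cond_exp_cong)
      show "AE \<omega> in M. g t (X t \<omega>) = (\<Sum>y\<in>S. g t y * ?I y \<omega>)"
        using measurable_space[OF meas[OF t]] fin
        by (intro AE_I2) (simp add: indicator_def of_bool_def if_distrib[of "\<lambda>a. _ * a"] cong: if_cong)
    qed (use int[OF t] in \<open>auto intro!: borel_measurable_integrable\<close>)
    moreover have "AE \<omega> in M. real_cond_exp M ?F (\<lambda>\<omega>. \<Sum>y\<in>S. g t y * ?I y \<omega>) \<omega> =
        (\<Sum>y\<in>S. real_cond_exp M ?F (\<lambda>\<omega>. g t y * ?I y \<omega>) \<omega>)"
      by (rule real_cond_exp_sum) (rule int[OF t])
    moreover have "AE \<omega> in M. \<forall>y\<in>S. real_cond_exp M ?F (\<lambda>\<omega>. g t y * ?I y \<omega>) \<omega> =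
        g t y * real_cond_exp M ?F (?I y) \<omega>"
      using fin by (intro AE_finite_allI real_cond_exp_cmult int[OF t])
    \<comment> \<open>Each state has its own exceptional null set; their union is null because
      \<open>S\<close> is finite.\<close>
    moreover have "AE \<omega> in M. \<forall>y\<in>S. real_cond_exp M ?F (?I y) \<omega> = p (t - s) (X s \<omega>) y"
      using markov[of s "t - s"] s by (intro AE_finite_allI fin) simp
    ultimately show ?thesis
      using AE_space
    proof eventually_elim
      case (elim \<omega>)
      have "X s \<omega> \<in> S" using measurable_space[OF meas[OF s(1)] elim(5)] by simp
      moreover have "real_cond_exp M ?F (\<lambda>\<omega>. g t (X t \<omega>)) \<omega> = (\<Sum>y\<in>S. p (t - s) (X s \<omega>) y * g t y)"
        using elim by (simp add: mult.commute)
      ultimately show ?case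
        using transition_space_time_harmonic[OF fin p, of g s "t - s" "X s \<omega>"] g s
        by (simp add: generator_on_def)
    qed
  qed
  have "(\<lambda>\<omega>. g t (X t \<omega>)) \<in> borel_measurable (natural_filtration M X t)" if "t \<ge> 0" for t
    by (rule measurable_compose[OF measurable_natural_filtration[OF that]]) simp
  then show ?thesis
    unfolding martingale_def by (intro conjI allI impI sub sets_natural_filtration_mono int cond)
qed

section \<open>The Ehrenfest rates\<close>

lemma sum_ehrenfest_rate:
  assumes "x \<le> N"
  shows "(\<Sum>y\<in>{0..N}. ehrenfest_rate N \<nu> \<mu> x y * d y) =
    \<nu> * (real N - real x) * d (Suc x) + \<mu> * real x * d (x - 1)"
proof -
  \<comment> \<open>The boundary takes care of itself: at \<open>x = N\<close> the state
    \<open>Suc x\<close> leaves the range but its rate is 0, and at \<open>x = 0\<close> the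
    truncated \<open>x - 1\<close> is \<open>x\<close> itself, with factor
    \<open>real x = 0\<close>.\<close>
  have "(\<Sum>y\<in>{0..N}. ehrenfest_rate N \<nu> \<mu> x y * d y) =
      (\<Sum>y\<in>{0..N}. (if y = Suc x then \<nu> * (real N - real x) * d (Suc x) else 0)
        + (if y = x - 1 then \<mu> * real x * d (x - 1) else 0))"
    by (intro sum.cong) (auto simp: ehrenfest_rate_def)
  also have "\<dots> = \<nu> * (real N - real x) * d (Suc x) + \<mu> * real x * d (x - 1)"
    using assms by (cases "x = N") (auto simp: sum.distrib)
  finally show ?thesis .
qed

theorem proposition1:
  fixes M :: "'a measure" and E :: "real \<Rightarrow> 'a \<Rightarrow> nat"
    and N :: nat and \<mu> \<nu> \<beta> :: real
  assumes "\<mu> > 0" and "\<nu> > 0" and "\<mu> + \<nu> = 1" and "N \<ge> 1"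
    and "ehrenfest_process M N \<nu> \<mu> E"
  shows "martingale M (natural_filtration M E)
           (\<lambda>t \<omega>. (1 - \<beta> * \<mu> * exp t) ^ E t \<omega> * (1 + \<beta> * \<nu> * exp t) ^ (N - E t \<omega>))"
proof (rule martingale_space_time_harmonic)
  show "markov_process_with_rates M {0..N} (ehrenfest_rate N \<nu> \<mu>) E"
    using assms(5) unfolding ehrenfest_process_def .
  fix t :: real and x assume "x \<in> {0..N}"
  then have x: "x \<le> N" by simp
  define a b where "a = 1 - \<beta> * \<mu> * exp t" and "b = 1 + \<beta> * \<nu> * exp t"
  define f where "f y = a ^ y * b ^ (N - y)" for y
  \<comment> \<open>A jump exchanges one factor \<open>a\<close> for one factor \<open>b\<close>, so
    every increment of \<open>f\<close> contains the gap \<open>b - a\<close>; the normalization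
    \<mu> + \<nu> = 1 makes this gap exactly \<open>\<beta> * exp t\<close>.\<close>
  have "a - b = - (\<mu> + \<nu>) * (\<beta> * exp t)"
    unfolding a_def b_def by (simp add: algebra_simps)
  then have b_eq: "b = a + \<beta> * exp t" using assms(3) by simp
  \<comment> \<open>The factor \<open>real N - real x\<close> is kept on both sides so that the
    identity also covers \<open>x = N\<close>, where the exponent \<open>N - x - 1\<close> is
    truncated. In \<open>down\<close> the factor \<open>real x\<close> does the same for
    \<open>x = 0\<close>.\<close>
  have up: "(real N - real x) * (f (Suc x) - f x) =
      - (real N - real x) * a ^ x * b ^ (N - x - 1) * (\<beta> * exp t)"
  proof (cases "x = N")
    case False
    then have "N - x = Suc (N - x - 1)" using x by simp
    then have "b ^ (N - x) = b * b ^ (N - x - 1)" by (metis power_Suc)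
    then show ?thesis unfolding f_def by (simp add: b_eq algebra_simps)
  qed simp
  have down: "real x * (f (x - 1) - f x) = real x * a ^ (x - 1) * b ^ (N - x) * (\<beta> * exp t)"
  proof (cases x)
    case (Suc k)
    then have "N - k = Suc (N - x)" using x by simp
    then show ?thesis unfolding f_def Suc by (simp add: b_eq algebra_simps)
  qed simp
  have "((\<lambda>t. (1 - \<beta> * \<mu> * exp t) ^ x * (1 + \<beta> * \<nu> * exp t) ^ (N - x)) has_real_derivative
      real x * a ^ (x - 1) * (- (\<beta> * \<mu> * exp t)) * b ^ (N - x)
      + a ^ x * (real (N - x) * b ^ (N - x - 1) * (\<beta> * \<nu> * exp t))) (at t)"
    unfolding a_def b_def by (auto intro!: derivative_eq_intros)
  \<comment> \<open>The terms match one by one: differentiating the power of \<open>a\<close> gives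
    minus \<mu> times \<open>down\<close>, and differentiating the power of \<open>b\<close> gives
    minus \<nu> times \<open>up\<close>.\<close>
  also have "real x * a ^ (x - 1) * (- (\<beta> * \<mu> * exp t)) * b ^ (N - x)
      + a ^ x * (real (N - x) * b ^ (N - x - 1) * (\<beta> * \<nu> * exp t)) =
      - (\<nu> * ((real N - real x) * (f (Suc x) - f x)) + \<mu> * (real x * (f (x - 1) - f x)))"
    unfolding up down using x by (simp add: of_nat_diff algebra_simps)
  also have "\<dots> = - (\<Sum>y\<in>{0..N}. ehrenfest_rate N \<nu> \<mu> x y * (f y - f x))"
    using sum_ehrenfest_rate[OF x, of \<nu> \<mu> "\<lambda>y. f y - f x"] by (simp add: mult.assoc)
  finally show "((\<lambda>t. (1 - \<beta> * \<mu> * exp t) ^ x * (1 + \<beta> * \<nu> * exp t) ^ (N - x)) has_real_derivative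
      - (\<Sum>y\<in>{0..N}. ehrenfest_rate N \<nu> \<mu> x y *
          ((1 - \<beta> * \<mu> * exp t) ^ y * (1 + \<beta> * \<nu> * exp t) ^ (N - y)
           - (1 - \<beta> * \<mu> * exp t) ^ x * (1 + \<beta> * \<nu> * exp t) ^ (N - x)))) (at t)"
    unfolding f_def a_def b_def .
qed

end
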